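(* Let $(A,B)$ be a commutative table algebra. Then $(A,B)$ comes from an association scheme if and only if $(A,B)\in\mathcal{S}$ and there is a matrix representation $D$ of $A$ which affords $\zeta$ and satisfies the following conditions for every $b\in B$: (1) $D(b^* )=D(b)^t$; (2) $D(b)$ is a $(0,1)$-matrix.
   Context: A C-algebra is a pair $(A,B)$, where $A$ is a finite dimensional associative algebra over $\mathbb{C}$ with identity $1_A$ and $B$ is a linear basis of $A$, such that: (I) $1_A\in B$ and the structure constants $\lambda_{abc}$ defined by $ab=\sum_{c\in B}\lambda_{abc}c$ ($a,b\in B$) are real; (II) there is a semilinear involutory anti-automorphism $*$ of $A$ with $B^*=B$; (III) for $a,b\in B$, $\lambda_{ab1_A}=\delta_{ab^*}|a|$ with $|a|>0$; (IV) the map $b\mapsto |b|$, $b\in B$, is (extends linearly to) a one-dimensional $*$-linear representation of $A$, called the degree map. A table algebra is a C-algebra whose structure constants are all nonnegative; it is commutative if $A$ is commutative. Put $|B^+|=\sum_{b\in B}|b|$. The standard feasible trace of $(A,B)$ is the linear function $\zeta:A\to\mathbb{C}$ with $\zeta(b)=\delta_{1_A b}|B^+|$ for $b\in B$. If $\zeta$ is a character of $A$, it is called the standard character of $(A,B)$, and $(A,B)$ is said to have the standard character condition. $\mathcal{S}$ is the class of all C-algebras having the standard character condition. A matrix representation $D$ affords $\zeta$ if $\mathrm{tr}\,D(a)=\zeta(a)$ for all $a\in A$. For an association scheme $(X,G)$ (on a finite set $X$), $\sigma_g$ is the adjacency matrix of $g\in G$ and $\mathbb{C}G=\bigoplus_{g\in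 G}\mathbb{C}\sigma_g$ is its complex adjacency algebra; it is a C-algebra with basis $\{\sigma_g:g\in G\}$, with $*$ the conjugate transpose. $(A,B)$ comes from an association scheme if it is (up to C-algebra isomorphism, i.e. a bijective $*$-algebra homomorphism mapping basis onto basis) the C-algebra $(\mathbb{C}G,\{\sigma_g:g\in G\})$ of some association scheme $(X,G)$. *)

theory Defs
  imports
    "HOL-Library.Disjoint_Sets"
    "Jordan_Normal_Form.Schur_Decomposition"
begin

text \<open>The algebra \<open>A\<close> is the whole type \<open>'a\<close>. Since \<open>scale\<close> is an action of \<open>complex\<close>,
  \<^const>\<open>finite_dimensional_vector_space\<close> with basis \<open>B\<close> makes \<open>A\<close> finite dimensional
  over the complex numbers.\<close>

locale based_star_algebra = finite_dimensional_vector_space scale B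
  for scale :: "complex \<Rightarrow> 'a::ring_1 \<Rightarrow> 'a" (infixr \<open>*s\<close> 75)
  and B :: "'a set"
  and star :: "'a \<Rightarrow> 'a" +
  assumes scale_mult_left: "(c *s x) * y = c *s (x * y)"
    and scale_mult_right: "x * (c *s y) = c *s (x * y)"
    and one_in_basis: "1 \<in> B"
    and structure_constants_real:
      "\<lbrakk>a \<in> B; b \<in> B; d \<in> B\<rbrakk> \<Longrightarrow> representation B (a * b) d \<in> \<real>"
    and star_add: "star (x + y) = star x + star y"
    and star_scale: "star (c *s x) = cnj c *s star x"
    and star_star: "star (star x) = x"
    and star_mult: "star (x * y) = star y * star x"
    and star_basis: "star ` B = B"
begin

definition structure_constant :: "'a \<Rightarrow> 'a \<Rightarrow> 'a \<Rightarrow> complex" where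
  "structure_constant a b c = representation B (a * b) c"

text \<open>The axioms of a C-algebra force \<open>|b|\<close> to be the coefficient of \<open>1\<close> in \<open>b b\<^sup>*\<close>. This is a
  real number by \<open>structure_constants_real\<close>, so taking \<^const>\<open>Re\<close> loses nothing.\<close>

definition basis_degree :: "'a \<Rightarrow> real" where
  "basis_degree b = Re (structure_constant b (star b) 1)"

definition linear_extension :: "('a \<Rightarrow> complex) \<Rightarrow> 'a \<Rightarrow> complex" where
  "linear_extension f x = (\<Sum>b\<in>B. representation B x b * f b)"

definition degree_map :: "'a \<Rightarrow> complex" where
  "degree_map = linear_extension (\<lambda>b. of_real (basis_degree b))"

definition total_degree :: real where
  "total_degree = (\<Sum>b\<in>B. basis_degree b)"

definition standard_feasible_trace :: "'a \<Rightarrow> complex" where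
  "standard_feasible_trace =
     linear_extension (\<lambda>b. if b = 1 then of_real total_degree else 0)"

end

locale c_algebra = based_star_algebra +
  assumes structure_constant_one:
      "\<lbrakk>a \<in> B; b \<in> B\<rbrakk> \<Longrightarrow>
        structure_constant a b 1 = (if a = star b then of_real (basis_degree a) else 0)"
    and basis_degree_pos: "b \<in> B \<Longrightarrow> basis_degree b > 0"
    and degree_map_one: "degree_map 1 = 1"
    and degree_map_mult: "degree_map (x * y) = degree_map x * degree_map y"
    and degree_map_star: "degree_map (star x) = cnj (degree_map x)"

locale table_algebra = c_algebra +
  assumes structure_constant_nonneg:
    "\<lbrakk>a \<in> B; b \<in> B; d \<in> B\<rbrakk> \<Longrightarrow> Re (structure_constant a b d) \<ge> 0"

locale commutative_table_algebra = table_algebra scale B star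
  for scale :: "complex \<Rightarrow> 'a::ring_1 \<Rightarrow> 'a" (infixr \<open>*s\<close> 75)
  and B :: "'a set"
  and star :: "'a \<Rightarrow> 'a" +
  assumes mult_commutative: "(x::'a) * y = y * x"

definition matrix_representation ::
  "(complex \<Rightarrow> 'a::ring_1 \<Rightarrow> 'a) \<Rightarrow> nat \<Rightarrow> ('a \<Rightarrow> complex mat) \<Rightarrow> bool" where
  "matrix_representation scale n D \<longleftrightarrow>
     (\<forall>x. D x \<in> carrier_mat n n) \<and>
     (\<forall>x y. D (x + y) = D x + D y) \<and>
     (\<forall>c x. D (scale c x) = c \<cdot>\<^sub>m D x) \<and>
     (\<forall>x y. D (x * y) = D x * D y) \<and>
     D 1 = 1\<^sub>m n"

definition mat_trace :: "complex mat \<Rightarrow> complex" where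
  "mat_trace M = (\<Sum>i<dim_row M. M $$ (i, i))"

definition affords :: "('a \<Rightarrow> complex mat) \<Rightarrow> ('a \<Rightarrow> complex) \<Rightarrow> bool" where
  "affords D \<chi> \<longleftrightarrow> (\<forall>x. mat_trace (D x) = \<chi> x)"

definition is_character ::
  "(complex \<Rightarrow> 'a::ring_1 \<Rightarrow> 'a) \<Rightarrow> ('a \<Rightarrow> complex) \<Rightarrow> bool" where
  "is_character scale \<chi> \<longleftrightarrow> (\<exists>n D. matrix_representation scale n D \<and> affords D \<chi>)"

text \<open>Membership in the class of C-algebras with the standard character condition.\<close>

locale standard_character_c_algebra = c_algebra +
  assumes standard_character: "is_character scale standard_feasible_trace"

definition zero_one_mat :: "complex mat \<Rightarrow> bool" where
  "zero_one_mat M \<longleftrightarrow> elements_mat M \<subseteq> {0, 1}"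

definition association_scheme :: "'x set \<Rightarrow> ('x \<times> 'x) set set \<Rightarrow> bool" where
  "association_scheme X G \<longleftrightarrow>
     finite X \<and> X \<noteq> {} \<and>
     partition_on (X \<times> X) G \<and>
     Id_on X \<in> G \<and>
     (\<forall>g\<in>G. g\<inverse> \<in> G) \<and>
     (\<forall>p\<in>G. \<forall>q\<in>G. \<forall>r\<in>G. \<exists>k::nat. \<forall>(y, z)\<in>r.
        card {x \<in> X. (y, x) \<in> p \<and> (x, z) \<in> q} = k)"

definition adjacency_mat :: "nat \<Rightarrow> (nat \<times> nat) set \<Rightarrow> complex mat" where
  "adjacency_mat n g = mat n n (\<lambda>(x, y). if (x, y) \<in> g then 1 else 0)"

definition adjacency_algebra :: "nat \<Rightarrow> (nat \<times> nat) set set \<Rightarrow> complex mat set" where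
  "adjacency_algebra n G =
     {mat n n (\<lambda>(x, y). \<Sum>g\<in>G. c g * adjacency_mat n g $$ (x, y)) |c. True}"

text \<open>Any finite point set may be relabelled as \<open>{..<n}\<close>, which is what \<^typ>\<open>complex mat\<close>
  uses as index set. A *-linear unital matrix representation that is a bijection onto the
  adjacency algebra and maps \<open>B\<close> onto the adjacency matrices is an isomorphism of C-algebras.\<close>

definition comes_from_association_scheme ::
  "(complex \<Rightarrow> 'a::ring_1 \<Rightarrow> 'a) \<Rightarrow> 'a set \<Rightarrow> ('a \<Rightarrow> 'a) \<Rightarrow> bool" where
  "comes_from_association_scheme scale B star \<longleftrightarrow>
     (\<exists>n G \<phi>. association_scheme {..<n} G \<and>
        matrix_representation scale n \<phi> \<and>
        (\<forall>x. \<phi> (star x) = mat_adjoint (\<phi> x)) \<and>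
        bij_betw \<phi> UNIV (adjacency_algebra n G) \<and>
        \<phi> ` B = adjacency_mat n ` G)"

end

theory Submission
  imports Defs
begin

text \<open>The \<open>(i, i)\<close> entry of \<open>D(b c\<^sup>*) = D(b) D(c)\<^sup>t\<close> is the inner product of the \<open>i\<close>-th rows of
  \<open>D(b)\<close> and \<open>D(c)\<close>. As soon as every basis element other than \<open>1\<close> is represented with zero
  diagonal, it is also the coefficient of \<open>1\<close> in \<open>b c\<^sup>*\<close>, that is \<open>\<delta>\<^sub>b\<^sub>c |b|\<close>. Hence the
  \<open>(0,1)\<close>-matrices \<open>D(b)\<close> have pairwise disjoint supports and row sums \<open>|b|\<close>. The zero diagonal is
  automatic for a scheme, and for a representation affording \<open>\<zeta>\<close> it follows from
  \<open>\<zeta>(b) = 0\<close>. In the first case counting a row of the sum over \<open>B\<close> gives \<open>n = |B\<^sup>+|\<close>; in the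
  second \<open>n = \<zeta>(1) = |B\<^sup>+|\<close>, so the supports cover all of \<open>X \<times> X\<close> and form
  a scheme, the entries of \<open>D(b c)\<close> giving its intersection numbers.\<close>

section \<open>Linear functionals and coordinates with respect to the basis\<close>

lemma (in based_star_algebra) additive_homogeneous_eq_linear_extension:
  assumes add: "\<And>x y. f (x + y) = f x + f y"
    and scale: "\<And>c x. f (c *s x) = c * f x"
  shows "f x = linear_extension f x"
proof -
  have zero: "f 0 = 0"
    using add[of 0 0] by simp
  have sum: "f (\<Sum>b\<in>S. g b) = (\<Sum>b\<in>S. f (g b))" if "finite S" for S and g :: "'a \<Rightarrow> 'a"
    using that by (induction S rule: finite_induct) (simp_all add: zero add)
  have "x = (\<Sum>b\<in>B. representation B x b *s b)"
    by (rule sum_representation_eq[symmetric])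
      (simp_all add: independent_Basis span_Basis finite_Basis)
  then have "f x = f (\<Sum>b\<in>B. representation B x b *s b)"
    by simp
  also have "\<dots> = linear_extension f x"
    by (simp add: linear_extension_def sum[OF finite_Basis] scale)
  finally show ?thesis .
qed

text \<open>With \<open>c = 1\<close> this is the coordinate functional of \<open>b\<close>; with
  \<open>b = 1\<close> and \<open>c\<close> the total degree it is the standard feasible
  trace.\<close>

lemma (in based_star_algebra) linear_extension_single:
  assumes "b \<in> B"
  shows "linear_extension (\<lambda>d. if d = b then c else 0) x = representation B x b * c"
proof -
  have "linear_extension (\<lambda>d. if d = b then c else 0) x =
      (\<Sum>d\<in>B. if d = b then representation B x d * c else 0)"
    unfolding linear_extension_def by (rule sum.cong) simp_all
  then show ?thesis
    using assms finite_Basis by simp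
qed

lemma (in based_star_algebra) linear_extension_basis:
  assumes "b \<in> B"
  shows "linear_extension f b = f b"
proof -
  have "linear_extension f b = (\<Sum>d\<in>B. if d = b then f d else 0)"
    unfolding linear_extension_def representation_basis[OF independent_Basis assms]
    by (rule sum.cong) simp_all
  then show ?thesis
    using assms finite_Basis by simp
qed

lemma (in based_star_algebra) linear_extension_cong:
  assumes "\<And>b. b \<in> B \<Longrightarrow> f b = g b"
  shows "linear_extension f x = linear_extension g x"
  using assms by (simp add: linear_extension_def)

lemma (in based_star_algebra) star_in_basis: "b \<in> B \<Longrightarrow> star b \<in> B"
  using star_basis by blast

lemma (in c_algebra) standard_feasible_trace_basis:
  assumes "b \<in> B"
  shows "standard_feasible_trace b = (if b = 1 then of_real total_degree else 0)"
  using linear_extension_basis[OF assms] by (simp add: standard_feasible_trace_def)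

section \<open>(0,1)-matrices, adjoints and adjacency matrices\<close>

lemma zero_one_mat_entry:
  assumes "zero_one_mat M" "i < dim_row M" "j < dim_col M"
  shows "M $$ (i, j) = 0 \<or> M $$ (i, j) = 1"
  using assms elements_matI[of M "dim_row M" "dim_col M" i j] by (auto simp: zero_one_mat_def)

text \<open>The diagonal entries are 0 or 1, hence nonnegative, and a vanishing trace leaves no room
  for a 1.\<close>

lemma zero_one_mat_diagonal_zero:
  assumes "zero_one_mat M" "M \<in> carrier_mat n n" "mat_trace M = 0" "i < n"
  shows "M $$ (i, i) = 0"
proof -
  have entry: "M $$ (k, k) = 0 \<or> M $$ (k, k) = 1" if "k < n" for k
    using zero_one_mat_entry[OF assms(1)] assms(2) that by auto
  have "(\<Sum>k<n. Re (M $$ (k, k))) = Re (mat_trace M)"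
    using assms(2) by (simp add: mat_trace_def)
  then have "(\<Sum>k<n. Re (M $$ (k, k))) = 0"
    using assms(3) by simp
  moreover have "0 \<le> Re (M $$ (k, k))" if "k < n" for k
    using entry[OF that] by auto
  ultimately have "Re (M $$ (i, i)) = 0"
    using assms(4) by (subst (asm) sum_nonneg_eq_0_iff) auto
  then show ?thesis
    using entry[OF assms(4)] by auto
qed

lemma index_mat_adjoint:
  assumes "M \<in> carrier_mat n m" "i < m" "j < n"
  shows "mat_adjoint M $$ (i, j) = cnj (M $$ (j, i))"
  using assms by (simp add: mat_adjoint_def mat_of_rows_def)

lemma mat_adjoint_carrier:
  assumes "M \<in> carrier_mat n m"
  shows "mat_adjoint M \<in> carrier_mat m n"
  using assms by (auto simp: mat_adjoint_def mat_of_rows_def)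

lemma adjacency_mat_carrier: "adjacency_mat n g \<in> carrier_mat n n"
  by (simp add: adjacency_mat_def)

lemma index_adjacency_mat:
  assumes "i < n" "j < n"
  shows "adjacency_mat n g $$ (i, j) = (if (i, j) \<in> g then 1 else 0)"
  using assms by (simp add: adjacency_mat_def)

lemma zero_one_adjacency_mat: "zero_one_mat (adjacency_mat n g)"
  by (auto simp: zero_one_mat_def elements_mat_def adjacency_mat_def)

lemma mat_adjoint_adjacency_mat:
  "mat_adjoint (adjacency_mat n g) = transpose_mat (adjacency_mat n g)"
proof (rule eq_matI)
  fix i j
  assume "i < dim_row (transpose_mat (adjacency_mat n g))"
    "j < dim_col (transpose_mat (adjacency_mat n g))"
  then have ij: "i < n" "j < n"
    using adjacency_mat_carrier[of n g] by auto
  then show "mat_adjoint (adjacency_mat n g) $$ (i, j) = transpose_mat (adjacency_mat n g) $$ (i, j)"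
    using index_mat_adjoint[OF adjacency_mat_carrier ij] adjacency_mat_carrier[of n g]
    by (simp add: index_adjacency_mat)
qed (use mat_adjoint_carrier[OF adjacency_mat_carrier[of n g]] adjacency_mat_carrier[of n g] in auto)

text \<open>A relation inside the square is recovered from its matrix as the set of positions with
  entry 1.\<close>

lemma inj_on_adjacency_mat:
  assumes "G \<subseteq> Pow ({..<n} \<times> {..<n})"
  shows "inj_on (adjacency_mat n) G"
proof (rule inj_on_inverseI)
  fix g assume "g \<in> G"
  then have "g \<subseteq> {..<n} \<times> {..<n}"
    using assms by blast
  then show "{(i, j). i < n \<and> j < n \<and> adjacency_mat n g $$ (i, j) = 1} = g"
    by (auto simp: index_adjacency_mat split: if_splits)
qed

text \<open>The adjacency matrices of a scheme add up to the all-ones matrix, because each pair lies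
  in exactly one block.\<close>

lemma sum_adjacency_mat_partition:
  assumes "partition_on ({..<n} \<times> {..<n}) G" "i < n" "j < n"
  shows "(\<Sum>g\<in>G. adjacency_mat n g $$ (i, j)) = 1"
proof -
  have fin: "finite G"
    using finite_elements[OF _ assms(1)] by simp
  have "(i, j) \<in> \<Union>G"
    using assms by (auto simp: partition_on_def)
  then obtain g where g: "g \<in> G" "(i, j) \<in> g"
    by blast
  have "(i, j) \<notin> h" if "h \<in> G" "h \<noteq> g" for h
    using partition_onD2[OF assms(1)] that g by (auto dest: disjointD)
  then have "(\<Sum>h\<in>G. adjacency_mat n h $$ (i, j)) = (\<Sum>h\<in>G. if h = g then 1 else 0)"
    using assms(2,3) g by (intro sum.cong) (auto simp: index_adjacency_mat)
  then show ?thesis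
    using fin g by simp
qed

section \<open>Representations by (0,1)-matrices with zero diagonal outside the identity\<close>

text \<open>Common ground of both directions. The equality of \<open>n\<close> with the total degree
  is not assumed here, since for a scheme it is itself derived from the row sums established in this
  locale.\<close>

locale zero_one_representation = c_algebra scale B star
  for scale :: "complex \<Rightarrow> 'a::ring_1 \<Rightarrow> 'a" (infixr \<open>*s\<close> 75)
  and B :: "'a set"
  and star :: "'a \<Rightarrow> 'a" +
  fixes n :: nat
    and D :: "'a \<Rightarrow> complex mat"
  assumes representation_D: "matrix_representation scale n D"
    and D_star_basis: "b \<in> B \<Longrightarrow> D (star b) = transpose_mat (D b)"
    and D_zero_one: "b \<in> B \<Longrightarrow> zero_one_mat (D b)"
    and D_zero_diagonal: "\<lbrakk>b \<in> B; b \<noteq> 1; i < n\<rbrakk> \<Longrightarrow> D b $$ (i, i) = 0"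
begin

lemma D_carrier: "D x \<in> carrier_mat n n"
  and D_add: "D (x + y) = D x + D y"
  and D_scale: "D (c *s x) = c \<cdot>\<^sub>m D x"
  and D_mult: "D (x * y) = D x * D y"
  and D_one: "D 1 = 1\<^sub>m n"
  using representation_D by (simp_all add: matrix_representation_def)

lemma D_dim [simp]: "dim_row (D x) = n" "dim_col (D x) = n"
  using D_carrier[of x] by auto

lemma D_entry:
  assumes "i < n" "j < n"
  shows "D x $$ (i, j) = (\<Sum>b\<in>B. representation B x b * D b $$ (i, j))"
proof -
  have "D x $$ (i, j) = linear_extension (\<lambda>x. D x $$ (i, j)) x"
    by (rule additive_homogeneous_eq_linear_extension) (use assms in \<open>simp_all add: D_add D_scale\<close>)
  then show ?thesis
    by (simp add: linear_extension_def)
qed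

lemma D_mult_entry:
  assumes "i < n" "j < n"
  shows "D (x * y) $$ (i, j) = (\<Sum>k<n. D x $$ (i, k) * D y $$ (k, j))"
  using assms by (simp add: D_mult scalar_prod_def atLeast0LessThan)

lemma D_basis_entry:
  assumes "b \<in> B" "i < n" "j < n"
  shows "D b $$ (i, j) = 0 \<or> D b $$ (i, j) = 1"
  using zero_one_mat_entry[OF D_zero_one] assms by simp

text \<open>Both sides are linear in \<open>x\<close>. On the basis each is 1 at the identity and 0
  elsewhere.\<close>

lemma D_diagonal_entry:
  assumes "i < n"
  shows "D x $$ (i, i) = representation B x 1"
proof -
  have "D x $$ (i, i) = linear_extension (\<lambda>b. D b $$ (i, i)) x"
    using assms by (simp add: D_entry[of i i x] linear_extension_def)
  also have "\<dots> = linear_extension (\<lambda>b. if b = 1 then 1 else 0) x"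
    using assms by (intro linear_extension_cong) (simp add: D_one D_zero_diagonal)
  finally show ?thesis
    by (simp add: linear_extension_single one_in_basis)
qed

lemma row_inner_product:
  assumes "b \<in> B" "c \<in> B" "i < n"
  shows "(\<Sum>k<n. D b $$ (i, k) * D c $$ (i, k)) = (if b = c then of_real (basis_degree b) else 0)"
proof -
  have "(\<Sum>k<n. D b $$ (i, k) * D c $$ (i, k)) = D (b * star c) $$ (i, i)"
    using assms by (simp add: D_mult_entry D_star_basis)
  also have "\<dots> = structure_constant b (star c) 1"
    using assms by (simp add: D_diagonal_entry structure_constant_def)
  finally show ?thesis
    using assms by (simp add: structure_constant_one star_in_basis star_star)
qed

text \<open>Entries equal to 0 or 1 are their own squares, so a row sum is the inner product of the
  row with itself.\<close>

lemma row_sum: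
  assumes "b \<in> B" "i < n"
  shows "(\<Sum>k<n. D b $$ (i, k)) = of_real (basis_degree b)"
proof -
  have "(\<Sum>k<n. D b $$ (i, k)) = (\<Sum>k<n. D b $$ (i, k) * D b $$ (i, k))"
    using D_basis_entry[OF assms] by (intro sum.cong) auto
  then show ?thesis
    using row_inner_product[OF assms(1) assms] by simp
qed

lemma sum_basis_row_sum:
  assumes "i < n"
  shows "(\<Sum>k<n. \<Sum>b\<in>B. D b $$ (i, k)) = of_real total_degree"
  by (subst sum.swap) (simp add: row_sum assms total_degree_def)

lemma disjoint_supports:
  assumes "b \<in> B" "c \<in> B" "b \<noteq> c" "i < n" "j < n" "D b $$ (i, j) = 1"
  shows "D c $$ (i, j) = 0"
proof -
  have entries: "D b $$ (i, k) * D c $$ (i, k) = 0 \<or> D b $$ (i, k) * D c $$ (i, k) = 1"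
    if "k < n" for k
    using D_basis_entry[OF assms(1,4) that] D_basis_entry[OF assms(2,4) that] by auto
  \<comment> \<open>Each term of the inner product is 0 or 1, so a vanishing sum forces every term
    to vanish. Taking real parts moves this argument to an ordered field.\<close>
  have "(\<Sum>k<n. Re (D b $$ (i, k) * D c $$ (i, k))) = Re (\<Sum>k<n. D b $$ (i, k) * D c $$ (i, k))"
    by (rule Re_sum[symmetric])
  also have "\<dots> = 0"
    using row_inner_product[OF assms(1,2,4)] assms(3) by simp
  finally have "(\<Sum>k<n. Re (D b $$ (i, k) * D c $$ (i, k))) = 0" .
  moreover have "0 \<le> Re (D b $$ (i, k) * D c $$ (i, k))" if "k < n" for k
    using entries[OF that]
    by (metis complex.sel(1) one_complex.sel(1) zero_complex.sel(1) order_refl zero_le_one)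
  ultimately have "Re (D b $$ (i, j) * D c $$ (i, j)) = 0"
    using assms(5) by (subst (asm) sum_nonneg_eq_0_iff) auto
  then show ?thesis
    using assms(6) D_basis_entry[OF assms(2,4,5)] by auto
qed

text \<open>All \<open>n\<close> diagonal entries of \<open>D x\<close> equal the coefficient of 1
  in \<open>x\<close>.\<close>

lemma affords_standard_feasible_trace:
  assumes "of_nat n = (of_real total_degree :: complex)"
  shows "affords D standard_feasible_trace"
  unfolding affords_def
proof
  fix x
  have "mat_trace (D x) = of_nat n * representation B x 1"
    by (simp add: mat_trace_def D_diagonal_entry)
  also have "\<dots> = standard_feasible_trace x"
    by (simp add: standard_feasible_trace_def linear_extension_single one_in_basis assms)
  finally show "mat_trace (D x) = standard_feasible_trace x" .
qed

lemma D_star: "D (star x) = mat_adjoint (D x)"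
proof (rule eq_matI)
  fix i j
  assume "i < dim_row (mat_adjoint (D x))" "j < dim_col (mat_adjoint (D x))"
  then have ij: "i < n" "j < n"
    using mat_adjoint_carrier[OF D_carrier[of x]] by auto
  \<comment> \<open>Since \<open>star\<close> is conjugate-linear, conjugating the entry makes it
    linear in \<open>x\<close>, so the comparison reduces to basis elements. There the entries are
    real and the transpose is the adjoint.\<close>
  let ?f = "\<lambda>x. cnj (D (star x) $$ (i, j))"
  have "?f x = linear_extension ?f x"
    using ij by (intro additive_homogeneous_eq_linear_extension)
      (simp_all add: star_add star_scale D_add D_scale)
  also have "\<dots> = linear_extension (\<lambda>b. D b $$ (j, i)) x"
  proof (rule linear_extension_cong)
    fix b assume "b \<in> B"
    then show "?f b = D b $$ (j, i)"
      using ij D_basis_entry[of b j i] by (auto simp: D_star_basis)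
  qed
  also have "\<dots> = D x $$ (j, i)"
    using ij by (simp add: D_entry[of j i x] linear_extension_def)
  finally have "cnj (cnj (D (star x) $$ (i, j))) = cnj (D x $$ (j, i))"
    by simp
  then show "D (star x) $$ (i, j) = mat_adjoint (D x) $$ (i, j)"
    using index_mat_adjoint[OF D_carrier ij] by simp
qed (use mat_adjoint_carrier[OF D_carrier[of x]] in auto)

section \<open>Supports of the basis matrices as the relations of a scheme\<close>

definition support :: "'a \<Rightarrow> (nat \<times> nat) set" where
  "support b = {(i, j). i < n \<and> j < n \<and> D b $$ (i, j) = 1}"

lemma adjacency_mat_support:
  assumes "b \<in> B"
  shows "adjacency_mat n (support b) = D b"
  using D_basis_entry[OF assms]
  by (intro eq_matI) (auto simp: adjacency_mat_def support_def)

lemma converse_support: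
  assumes "b \<in> B"
  shows "(support b)\<inverse> = support (star b)"
  using assms by (auto simp: support_def D_star_basis)

lemma support_one: "support 1 = Id_on {..<n}"
  by (auto simp: support_def D_one split: if_splits)

text \<open>Row 0, which exists because \<open>n > 0\<close>, has the positive sum
  \<open>basis_degree b\<close>.\<close>

lemma support_nonempty:
  assumes "b \<in> B" "n > 0"
  shows "support b \<noteq> {}"
proof
  assume "support b = {}"
  then have "D b $$ (0, k) = 0" if "k < n" for k
    using D_basis_entry[OF assms that] assms(2) that by (auto simp: support_def)
  then have "basis_degree b = 0"
    using row_sum[OF assms] by simp
  then show False
    using basis_degree_pos[OF assms(1)] by simp
qed

text \<open>At a position in the support of \<open>b\<close> all other basis matrices vanish, so
  reading that entry is the coordinate functional of \<open>b\<close>. This yields both the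
  intersection numbers and the injectivity of \<open>D\<close>.\<close>

lemma D_entry_support:
  assumes "b \<in> B" "(i, j) \<in> support b"
  shows "D x $$ (i, j) = representation B x b"
proof -
  have ij: "i < n" "j < n" "D b $$ (i, j) = 1"
    using assms(2) by (auto simp: support_def)
  have "D x $$ (i, j) = linear_extension (\<lambda>d. D d $$ (i, j)) x"
    using ij by (simp add: D_entry[of i j x] linear_extension_def)
  also have "\<dots> = linear_extension (\<lambda>d. if d = b then 1 else 0) x"
    using disjoint_supports[OF assms(1) _ _ ij] ij(3) by (intro linear_extension_cong) auto
  finally show ?thesis
    by (simp add: linear_extension_single assms(1))
qed

text \<open>For (0,1)-entries each summand of the matrix product is an indicator, and the sum counts
  the intermediate points.\<close>

lemma card_support_product:
  assumes "b \<in> B" "c \<in> B" "i < n" "j < n"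
  shows "of_nat (card {k \<in> {..<n}. (i, k) \<in> support b \<and> (k, j) \<in> support c}) = D (b * c) $$ (i, j)"
proof -
  have "D (b * c) $$ (i, j) =
      (\<Sum>k<n. if (i, k) \<in> support b \<and> (k, j) \<in> support c then 1 else 0)"
    unfolding D_mult_entry[OF assms(3,4)]
  proof (rule sum.cong)
    fix k assume "k \<in> {..<n}"
    then show "D b $$ (i, k) * D c $$ (k, j) =
        (if (i, k) \<in> support b \<and> (k, j) \<in> support c then 1 else 0)"
      using D_basis_entry[OF assms(1,3), of k] D_basis_entry[OF assms(2) _ assms(4), of k] assms(3,4)
      by (auto simp: support_def)
  qed simp
  then show ?thesis
    by (simp add: sum.If_cases Collect_conj_eq lessThan_def)
qed

text \<open>Disjointness bounds every entry of the sum of the basis matrices by 1. An uncovered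
  position would then bring the total of its row below \<open>n\<close>, whereas that total is the
  total degree.\<close>

lemma supports_cover:
  assumes "of_nat n = (of_real total_degree :: complex)" "i < n" "j < n"
  shows "\<exists>b\<in>B. (i, j) \<in> support b"
proof (rule ccontr)
  assume none: "\<not> (\<exists>b\<in>B. (i, j) \<in> support b)"
  \<comment> \<open>\<open>?s k\<close> is the number of supports containing
    \<open>(i, k)\<close>.\<close>
  let ?s = "\<lambda>k. \<Sum>b\<in>B. Re (D b $$ (i, k))"
  have le: "?s k \<le> 1" if "k < n" for k
  proof (cases "\<exists>b\<in>B. D b $$ (i, k) = 1")
    case True
    then obtain b where b: "b \<in> B" "D b $$ (i, k) = 1"
      by blast
    have "?s k = (\<Sum>c\<in>B. if c = b then 1 else 0)"
      using disjoint_supports[OF b(1) _ _ assms(2) that b(2)] b(2) by (intro sum.cong) auto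
    then show ?thesis
      using b(1) finite_Basis by simp
  next
    case False
    then have "?s k = 0"
      using D_basis_entry[OF _ assms(2) that] by (intro sum.neutral) auto
    then show ?thesis
      by simp
  qed
  have "?s j = 0"
    using none D_basis_entry[OF _ assms(2,3)] assms(2,3)
    by (intro sum.neutral) (auto simp: support_def)
  then have "(\<Sum>k<n. ?s k) < (\<Sum>k<n. 1)"
    using le assms(3) by (intro sum_strict_mono_ex1) (auto intro: bexI[of _ j])
  moreover have "(\<Sum>k<n. ?s k) = real n"
    using arg_cong[OF sum_basis_row_sum[OF assms(2)], of Re] arg_cong[OF assms(1), of Re]
    by (simp add: Re_sum)
  ultimately show False
    by simp
qed

lemma disjoint_support_pairs:
  assumes "b \<in> B" "c \<in> B" "b \<noteq> c"
  shows "support b \<inter> support c = {}"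
  using disjoint_supports[OF assms] by (auto simp: support_def)

lemma inj_on_support:
  assumes "n > 0"
  shows "inj_on support B"
  using disjoint_support_pairs support_nonempty[OF _ assms] by (fastforce intro: inj_onI)

lemma association_scheme_supports:
  assumes "of_nat n = (of_real total_degree :: complex)" "n > 0"
  shows "association_scheme {..<n} (support ` B)"
  unfolding association_scheme_def
proof (intro conjI)
  show "partition_on ({..<n} \<times> {..<n}) (support ` B)"
  proof (rule partition_onI)
    show "\<Union>(support ` B) = {..<n} \<times> {..<n}"
      using supports_cover[OF assms(1)] by (auto simp: support_def)
    show "disjnt p q" if "p \<in> support ` B" "q \<in> support ` B" "p \<noteq> q" for p q
      using that disjoint_support_pairs by (auto simp: disjnt_def)
    show "{} \<notin> support ` B"
      using support_nonempty[OF _ assms(2)] by force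
  qed
  show "Id_on {..<n} \<in> support ` B"
    using support_one one_in_basis by (metis imageI)
  show "\<forall>g\<in>support ` B. g\<inverse> \<in> support ` B"
    using converse_support star_in_basis by auto
  show "\<forall>p\<in>support ` B. \<forall>q\<in>support ` B. \<forall>r\<in>support ` B. \<exists>k::nat. \<forall>(y, z)\<in>r.
      card {x \<in> {..<n}. (y, x) \<in> p \<and> (x, z) \<in> q} = k"
  proof (intro ballI)
    fix p q r
    assume "p \<in> support ` B" "q \<in> support ` B" "r \<in> support ` B"
    then obtain b c d where bcd: "b \<in> B" "c \<in> B" "d \<in> B"
      and pqr: "p = support b" "q = support c" "r = support d"
      by blast
    \<comment> \<open>The count is an entry of \<open>D (b * c)\<close> at a position in the support
      of \<open>d\<close>, which is the coefficient of \<open>d\<close> whatever the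
      position.\<close>
    have "of_nat (card {x \<in> {..<n}. (y, x) \<in> p \<and> (x, z) \<in> q}) = structure_constant b c d"
      if "(y, z) \<in> r" for y z
    proof -
      have "y < n" "z < n"
        using that by (auto simp: pqr support_def)
      then show ?thesis
        using card_support_product[OF bcd(1,2)] D_entry_support[OF bcd(3)] that
        by (simp add: pqr structure_constant_def)
    qed
    \<comment> \<open>The structure constant is a complex number, so the counts are compared with
      one another, and the count at one chosen pair serves as the natural number
      \<open>k\<close>.\<close>
    then have eq: "card {x \<in> {..<n}. (y, x) \<in> p \<and> (x, z) \<in> q} =
        card {x \<in> {..<n}. (y', x) \<in> p \<and> (x, z') \<in> q}"
      if "(y, z) \<in> r" "(y', z') \<in> r" for y z y' z'
      using that by (metis (no_types, lifting) of_nat_eq_iff)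
    show "\<exists>k::nat. \<forall>(y, z)\<in>r. card {x \<in> {..<n}. (y, x) \<in> p \<and> (x, z) \<in> q} = k"
    proof (cases "r = {}")
      case False
      then obtain y z where "(y, z) \<in> r"
        by fastforce
      then have "\<forall>(y', z')\<in>r. card {x \<in> {..<n}. (y', x) \<in> p \<and> (x, z') \<in> q} =
          card {x \<in> {..<n}. (y, x) \<in> p \<and> (x, z) \<in> q}"
        using eq by blast
      then show ?thesis
        by (rule exI)
    qed simp
  qed
qed (use assms(2) in auto)

section \<open>The isomorphism onto the adjacency algebra\<close>

lemma inj_D:
  assumes "n > 0"
  shows "inj D"
proof (rule injI)
  fix x y assume "D x = D y"
  then have "representation B x b = representation B y b" if "b \<in> B" for b
    using support_nonempty[OF that assms] D_entry_support[OF that] by (metis ex_in_conv surj_pair)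
  then have "(\<Sum>b\<in>B. representation B x b *s b) = (\<Sum>b\<in>B. representation B y b *s b)"
    by simp
  then show "x = y"
    by (simp add: sum_representation_eq independent_Basis span_Basis finite_Basis)
qed

lemma range_D:
  assumes "n > 0"
  shows "range D = adjacency_algebra n (support ` B)"
proof -
  have entries: "(\<Sum>g\<in>support ` B. c g * adjacency_mat n g $$ (i, j)) =
      (\<Sum>b\<in>B. c (support b) * D b $$ (i, j))" for c :: "(nat \<times> nat) set \<Rightarrow> complex" and i j
    by (simp add: sum.reindex[OF inj_on_support[OF assms]] adjacency_mat_support)
  show ?thesis
  proof (intro equalityI subsetI)
    fix M assume "M \<in> range D"
    then obtain x where x: "M = D x"
      by blast
    \<comment> \<open>Elements of the adjacency algebra have coefficients indexed by relations. As
      \<open>support\<close> is injective on \<open>B\<close>, each relation determines the basis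
      element whose coefficient it receives.\<close>
    let ?c = "\<lambda>g. representation B x (inv_into B support g)"
    have "D x = mat n n (\<lambda>(i, j). \<Sum>g\<in>support ` B. ?c g * adjacency_mat n g $$ (i, j))"
      unfolding entries
      by (rule eq_matI) (simp_all add: D_entry[of _ _ x] inj_on_support[OF assms])
    then show "M \<in> adjacency_algebra n (support ` B)"
      unfolding x adjacency_algebra_def mem_Collect_eq by (intro exI[of _ ?c]) simp
  next
    fix M assume "M \<in> adjacency_algebra n (support ` B)"
    then obtain c where M: "M = mat n n (\<lambda>(i, j). \<Sum>g\<in>support ` B. c g * adjacency_mat n g $$ (i, j))"
      by (auto simp: adjacency_algebra_def)
    let ?x = "\<Sum>b\<in>B. c (support b) *s b"
    have sum: "D (\<Sum>b\<in>S. c (support b) *s b) $$ (i, j) = (\<Sum>b\<in>S. c (support b) * D b $$ (i, j))"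
      if "finite S" "i < n" "j < n" for S i j
      using that(1)
    proof (induction S rule: finite_induct)
      case empty
      \<comment> \<open>Homogeneity at the scalar 0 makes every entry of \<open>D 0\<close>
        vanish.\<close>
      have "D 0 = 0 \<cdot>\<^sub>m D 0"
        using D_scale[of 0 0] by simp
      then have "D 0 $$ (i, j) = (0 \<cdot>\<^sub>m D 0) $$ (i, j)"
        by (rule arg_cong)
      then show ?case
        using that(2,3) by simp
    qed (simp add: D_add D_scale that(2,3))
    have "M = D ?x"
      unfolding M entries by (rule eq_matI) (simp_all add: sum[OF finite_Basis])
    then show "M \<in> range D"
      by blast
  qed
qed

lemma comes_from_association_scheme:
  assumes "of_nat n = (of_real total_degree :: complex)" "n > 0"
  shows "comes_from_association_scheme scale B star"
  unfolding comes_from_association_scheme_def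
proof (intro exI conjI allI)
  show "association_scheme {..<n} (support ` B)"
    using assms by (rule association_scheme_supports)
  show "bij_betw D UNIV (adjacency_algebra n (support ` B))"
    using inj_D range_D assms(2) by (simp add: bij_betw_def)
  show "D ` B = adjacency_mat n ` support ` B"
    by (simp add: image_image adjacency_mat_support)
qed (rule representation_D D_star)+

end

section \<open>From schemes and from the standard character to such representations\<close>

lemma (in c_algebra) zero_one_representation_of_scheme:
  assumes scheme: "association_scheme {..<n} G"
    and rep: "matrix_representation scale n \<phi>"
    and star: "\<And>x. \<phi> (star x) = mat_adjoint (\<phi> x)"
    and inj: "inj \<phi>"
    and basis: "\<phi> ` B = adjacency_mat n ` G"
  shows "zero_one_representation scale B star n \<phi>"
    and "of_nat n = (of_real total_degree :: complex)"
proof -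
  have part: "partition_on ({..<n} \<times> {..<n}) G" and Id: "Id_on {..<n} \<in> G" and "n > 0"
    using scheme by (auto simp: association_scheme_def)
  have adj: "\<exists>g\<in>G. \<phi> b = adjacency_mat n g" if "b \<in> B" for b
    using basis that by blast
  have one: "\<phi> 1 = adjacency_mat n (Id_on {..<n})"
    using rep by (auto simp: matrix_representation_def adjacency_mat_def intro!: eq_matI)
  have diag: "\<phi> b $$ (i, i) = 0" if b: "b \<in> B" "b \<noteq> 1" and i: "i < n" for b i
  proof -
    obtain g where g: "g \<in> G" "\<phi> b = adjacency_mat n g"
      using adj b by blast
    \<comment> \<open>Injectivity separates the block of \<open>b\<close> from the diagonal block,
      and distinct blocks of a partition are disjoint.\<close>
    have "\<phi> b \<noteq> \<phi> 1"
      using inj b(2) by (auto dest: injD)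
    then have "g \<noteq> Id_on {..<n}"
      using g one by auto
    then have "(i, i) \<notin> g"
      using disjointD[OF partition_onD2[OF part] g(1) Id] i by auto
    then show ?thesis
      using g(2) i by (simp add: index_adjacency_mat)
  qed
  interpret zero_one_representation scale B star n \<phi>
  proof unfold_locales
    fix b assume "b \<in> B"
    then obtain g where "\<phi> b = adjacency_mat n g"
      using adj by blast
    then show "\<phi> (star b) = transpose_mat (\<phi> b)" "zero_one_mat (\<phi> b)"
      by (simp_all add: star mat_adjoint_adjacency_mat zero_one_adjacency_mat)
  qed (use rep diag in auto)
  show "zero_one_representation scale B star n \<phi>"
    by (rule zero_one_representation_axioms)
  \<comment> \<open>One row suffices: row 0 of the all-ones matrix sums to \<open>n\<close>, while
    the row sums of the basis matrices add up to the total degree.\<close>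
  have "(\<Sum>b\<in>B. \<phi> b $$ (0, k)) = 1" if "k < n" for k
  proof -
    \<comment> \<open>The sum passes from \<open>B\<close> to \<open>G\<close> through the common
      set of matrices, on which both indexings are injective.\<close>
    have "(\<Sum>b\<in>B. \<phi> b $$ (0, k)) = (\<Sum>M\<in>\<phi> ` B. M $$ (0, k))"
      using inj by (simp add: sum.reindex inj_on_def)
    also have "\<dots> = (\<Sum>g\<in>G. adjacency_mat n g $$ (0, k))"
    proof -
      have "G \<subseteq> Pow ({..<n} \<times> {..<n})"
        using part by (auto simp: partition_on_def)
      then show ?thesis
        unfolding basis by (simp add: sum.reindex[OF inj_on_adjacency_mat])
    qed
    also have "\<dots> = 1"
      using sum_adjacency_mat_partition[OF part \<open>n > 0\<close> that] .
    finally show ?thesis .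
  qed
  then show "of_nat n = (of_real total_degree :: complex)"
    using sum_basis_row_sum[OF \<open>n > 0\<close>] by simp
qed

lemma (in c_algebra) zero_one_representation_of_standard:
  assumes rep: "matrix_representation scale n D"
    and affords: "affords D standard_feasible_trace"
    and basis: "\<And>b. b \<in> B \<Longrightarrow> D (star b) = transpose_mat (D b) \<and> zero_one_mat (D b)"
  shows "zero_one_representation scale B star n D"
    and "of_nat n = (of_real total_degree :: complex)"
proof -
  have trace: "mat_trace (D x) = standard_feasible_trace x" for x
    using affords by (simp add: affords_def)
  have carrier: "D x \<in> carrier_mat n n" for x
    using rep by (simp add: matrix_representation_def)
  have "D b $$ (i, i) = 0" if "b \<in> B" "b \<noteq> 1" "i < n" for b i
    using that basis[OF that(1)] zero_one_mat_diagonal_zero[OF _ carrier _ that(3)]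
      trace[of b] standard_feasible_trace_basis[OF that(1)]
    by simp
  then show "zero_one_representation scale B star n D"
    using rep basis by unfold_locales auto
  have "mat_trace (D 1) = of_nat n"
    using rep by (simp add: matrix_representation_def mat_trace_def)
  then show "of_nat n = (of_real total_degree :: complex)"
    using trace[of 1] standard_feasible_trace_basis[OF one_in_basis] by simp
qed

lemma (in c_algebra) total_degree_pos: "total_degree > 0"
  unfolding total_degree_def
  using one_in_basis basis_degree_pos finite_Basis by (intro sum_pos) auto

theorem corollary4p7:
  fixes scale :: "complex \<Rightarrow> 'a::ring_1 \<Rightarrow> 'a"
    and B :: "'a set"
    and star :: "'a \<Rightarrow> 'a"
  assumes "commutative_table_algebra scale B star"
  shows "comes_from_association_scheme scale B star \<longleftrightarrow>
    standard_character_c_algebra scale B star \<and>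
    (\<exists>n D. matrix_representation scale n D \<and>
       affords D (based_star_algebra.standard_feasible_trace scale B star) \<and>
       (\<forall>b\<in>B. D (star b) = transpose_mat (D b) \<and> zero_one_mat (D b)))"
proof -
  interpret commutative_table_algebra scale B star
    by (rule assms)
  show ?thesis
  proof
    assume "comes_from_association_scheme scale B star"
    then obtain n G \<phi> where scheme: "association_scheme {..<n} G"
      and rep: "matrix_representation scale n \<phi>"
      and star: "\<And>x. \<phi> (star x) = mat_adjoint (\<phi> x)"
      and inj: "inj \<phi>"
      and basis: "\<phi> ` B = adjacency_mat n ` G"
      unfolding comes_from_association_scheme_def bij_betw_def by blast
    note zero_one = zero_one_representation_of_scheme[OF scheme rep star inj basis]
    interpret \<phi>: zero_one_representation scale B star n \<phi>
      by (rule zero_one(1))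
    have affords: "affords \<phi> standard_feasible_trace"
      using zero_one(2) by (rule \<phi>.affords_standard_feasible_trace)
    \<comment> \<open>The isomorphism \<phi>, read as a matrix representation, itself shows that the
      standard feasible trace is a character.\<close>
    have "standard_character_c_algebra scale B star"
      using rep affords by unfold_locales (auto simp: is_character_def)
    then show "standard_character_c_algebra scale B star \<and>
      (\<exists>n D. matrix_representation scale n D \<and> affords D standard_feasible_trace \<and>
        (\<forall>b\<in>B. D (star b) = transpose_mat (D b) \<and> zero_one_mat (D b)))"
      using rep affords \<phi>.D_star_basis \<phi>.D_zero_one by blast
  next
    assume "standard_character_c_algebra scale B star \<and>
      (\<exists>n D. matrix_representation scale n D \<and> affords D standard_feasible_trace \<and>
        (\<forall>b\<in>B. D (star b) = transpose_mat (D b) \<and> zero_one_mat (D b)))"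
    then obtain n D where D: "matrix_representation scale n D" "affords D standard_feasible_trace"
      "\<And>b. b \<in> B \<Longrightarrow> D (star b) = transpose_mat (D b) \<and> zero_one_mat (D b)"
      by blast
    note zero_one = zero_one_representation_of_standard[OF D(1) D(2) D(3)]
    \<comment> \<open>A scheme has a nonempty point set; here \<open>n\<close> is the total degree,
      a sum of positive degrees.\<close>
    have "n > 0"
      using arg_cong[OF zero_one(2), of Re] total_degree_pos by simp
    then show "comes_from_association_scheme scale B star"
      using zero_one_representation.comes_from_association_scheme[OF zero_one] by simp
  qed
qed

end
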